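(* Let $\mathcal{P}$ be the set of integer partitions that satisfy Condition($2$), have all parts at least $2$, and in which the part $2$ appears at most once. Then, as formal power series in $x,q$, $$\sum_{\pi\in\mathcal{P}}x^{\ell(\pi)}q^{|\pi|}=\sum_{i,j,k\ge 0}\frac{x^{i+2j+3k}q^{\frac{(i+2j+3k)(i+2j+3k-1)}{2}+2i+j^2+4j+5k}}{(q;q)_i\,(q^2;q^2)_j\,(q^3;q^3)_k},$$ and also, writing $M=i+2j+3k+4l$, $$\sum_{\pi\in\mathcal{P}}x^{\ell(\pi)}q^{|\pi|}=\sum_{i,j,k,l\ge 0}(-1)^l\frac{x^{M}q^{\frac{M(M-1)}{2}+2i+5j+5k+2l^2+8l}}{(q;q)_i\,(q^2;q^2)_j\,(q^3;q^3)_k\,(q^4;q^4)_l}.$$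
   Context: Partitions are finite weakly increasing sequences of positive integers (the empty partition is included); $\ell(\pi)$ is the number of parts and $|\pi|$ the sum of the parts of $\pi$. For a fixed integer $c$, a partition $\pi=\lambda_1+\lambda_2+\cdots+\lambda_m$ with $\lambda_1\le\lambda_2\le\cdots\le\lambda_m$ satisfies Condition($c$) if $\lambda_{s+3}-\lambda_s\ge 3$ for all $1\le s\le m-3$, and, for all $1\le s\le m-2$, if $\lambda_{s+2}-\lambda_s\le 1$ then $\lambda_s+\lambda_{s+1}+\lambda_{s+2}\equiv c\pmod 3$. For $n\ge 0$, $(a;q)_n=\prod_{0\le t<n}(1-aq^t)$. All identities are identities of formal power series. *)

theory Defs
  imports "HOL-Analysis.Analysis" "HOL-Number_Theory.Cong"
begin

definition partitions :: "nat list set" where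
  "partitions = {\<pi>. sorted \<pi> \<and> (\<forall>p\<in>set \<pi>. p > 0)}"

text \<open>List positions start at 0, so the part with index \<open>s\<close> (starting at 1) in the
  informal definition is \<open>\<pi> ! (s - 1)\<close>.\<close>

definition condition :: "int \<Rightarrow> nat list \<Rightarrow> bool" where
  "condition c \<pi> \<longleftrightarrow>
     (\<forall>s. s + 3 < length \<pi> \<longrightarrow> int (\<pi> ! (s + 3)) - int (\<pi> ! s) \<ge> 3) \<and>
     (\<forall>s. s + 2 < length \<pi> \<longrightarrow> int (\<pi> ! (s + 2)) - int (\<pi> ! s) \<le> 1 \<longrightarrow>
        [int (\<pi> ! s) + int (\<pi> ! (s + 1)) + int (\<pi> ! (s + 2)) = c] (mod 3))"

definition P_set :: "nat list set" where
  "P_set = {\<pi> \<in> partitions. condition 2 \<pi> \<and> (\<forall>p\<in>set \<pi>. p \<ge> 2) \<and> count_list \<pi> 2 \<le> 1}"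

definition qpoch :: "'a :: comm_ring_1 \<Rightarrow> 'a \<Rightarrow> nat \<Rightarrow> 'a" where
  "qpoch a q n = (\<Prod>t<n. 1 - a * q ^ t)"

text \<open>The ring of power series in \<open>x\<close> and \<open>q\<close> is \<open>\<rat>[[x]][[q]]\<close>, with \<open>q\<close> the outer variable.
  The library topology on it is the \<open>q\<close>-adic one (\<open>\<rat>[[x]]\<close> is treated as discrete), so convergence
  of a sum over an index set implies convergence coefficientwise in \<open>x\<close> and \<open>q\<close>.
  Only finitely many partitions have a given size, so a generating function of partitions
  converges with \<open>q\<close> outermost; it need not if \<open>x\<close> is outermost.\<close>

abbreviation x_var :: "rat fps fps" where
  "x_var \<equiv> fps_const fps_X"

abbreviation q_var :: "rat fps fps" where
  "q_var \<equiv> fps_X"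

end

(* Recording the multiplicities of the two smallest admissible parts, Condition(2) splits into
   four classes of partitions, and peeling off the smallest part k gives a linear system between
   their generating functions.  Eliminating three of them leaves, for the class of the theorem,
     F(x) = F(xq) + x q^2 F(xq) + (x^2 q^6 + x^3 q^8) F(xq^3) - x^4 q^13 F(xq^4).
   Dropping the factor q^(M(M-1)/2), the first multisum becomes by Euler's identities the product
     H(x) = (-x^2 q^5; q^2) / ((x q^2; q) (x^3 q^5; q^3)),
   so (1 - x q^2) (1 - x^3 q^5) H(x) = (1 + x^2 q^5) H(xq); the second one gives the same product
   since (-y; q^2) = (y^2; q^4) / (y; q^2).  Multiplying the coefficient of x^M by q^(M(M-1)/2)
   turns this relation into the equation for F, which determines F from F(0) = 1. *)

theory Submission
  imports Defs
begin

unbundle no vec_syntax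
unbundle fps_syntax

section \<open>Partitions satisfying Condition(2)\<close>

definition cond2_from :: "nat \<Rightarrow> nat list set" where
  "cond2_from k = {\<pi>. sorted \<pi> \<and> condition 2 \<pi> \<and> (\<forall>p\<in>set \<pi>. k \<le> p)}"

text \<open>On \<open>cond2_from k\<close> the bounds for \<open>a = 0\<close> and \<open>b = 0\<close> are vacuous, \<open>a = 1\<close> says that the part
  \<open>k\<close> occurs at most once, and \<open>b = 2\<close> that at most two parts are \<open>k\<close> or \<open>k + 1\<close>.\<close>

definition cond2_gap :: "nat \<Rightarrow> nat \<Rightarrow> nat \<Rightarrow> nat list set" where
  "cond2_gap k a b = {\<pi> \<in> cond2_from k.
     (1 < length \<pi> \<longrightarrow> k + a \<le> \<pi> ! 1) \<and> (2 < length \<pi> \<longrightarrow> k + b \<le> \<pi> ! 2)}"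

section \<open>Effect of prepending a part to a partition\<close>

lemma condition_Cons:
  "condition c (p # \<pi>) \<longleftrightarrow> condition c \<pi> \<and>
     (2 < length \<pi> \<longrightarrow> int (\<pi> ! 2) - int p \<ge> 3) \<and>
     (1 < length \<pi> \<longrightarrow> int (\<pi> ! 1) - int p \<le> 1 \<longrightarrow>
       [int p + int (\<pi> ! 0) + int (\<pi> ! 1) = c] (mod 3))"
proof -
  have split: "(\<forall>s. Q s) \<longleftrightarrow> Q 0 \<and> (\<forall>s. Q (Suc s))" for Q :: "nat \<Rightarrow> bool"
    by (metis nat.exhaust)
  show ?thesis
    unfolding condition_def
    by (subst (1 2) split) (auto simp: numeral_2_eq_2 numeral_3_eq_3)
qed

lemma Nil_cond2_from [simp]: "[] \<in> cond2_from k"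
  by (simp add: cond2_from_def condition_def)

text \<open>Sortedness and the lower bound on the tail merge into membership of the tail in
  \<open>cond2_from p\<close>, so k constrains only the first part. The congruence becomes a
  remainder of natural numbers, which arithmetic can decide.\<close>

lemma cond2_from_Cons:
  "p # \<pi> \<in> cond2_from k \<longleftrightarrow> k \<le> p \<and> \<pi> \<in> cond2_from p \<and>
     (2 < length \<pi> \<longrightarrow> p + 3 \<le> \<pi> ! 2) \<and>
     (1 < length \<pi> \<longrightarrow> \<pi> ! 1 \<le> p + 1 \<longrightarrow> (p + \<pi> ! 0 + \<pi> ! 1) mod 3 = 2)"
proof -
  have "[int a + int b + int c = 2] (mod 3) \<longleftrightarrow> (a + b + c) mod 3 = 2" for a b c
    using cong_int_iff[of "a + b + c" 2 3] by (simp add: cong_def)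
  then show ?thesis
    unfolding cond2_from_def condition_Cons mem_Collect_eq by auto
qed

lemma cond2_from_mono: "\<pi> \<in> cond2_from k \<Longrightarrow> j \<le> k \<Longrightarrow> \<pi> \<in> cond2_from j"
  by (auto simp: cond2_from_def)

lemma cond2_from_nth:
  assumes "\<pi> \<in> cond2_from k"
  shows "i < length \<pi> \<Longrightarrow> k \<le> \<pi> ! i" "i \<le> j \<Longrightarrow> j < length \<pi> \<Longrightarrow> \<pi> ! i \<le> \<pi> ! j"
  using assms by (auto simp: cond2_from_def sorted_iff_nth_mono)

text \<open>Three smallest parts spanning at most 1 must here be k, k + 1, k + 1, with sum 3k + 2,
  so the congruence holds for free. What remains is the gap of 3 to the fourth part, which is
  \<open>\<pi> ! 2\<close>; measured from k + 1 it is the bound b = 2.\<close>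

lemma Cons_cond2_from_iff:
  assumes "\<pi> \<noteq> [] \<longrightarrow> k < \<pi> ! 0"
  shows "k # \<pi> \<in> cond2_from k \<longleftrightarrow> \<pi> \<in> cond2_gap (k + 1) 0 2"
proof
  assume *: "k # \<pi> \<in> cond2_from k"
  then have "\<pi> \<in> cond2_from (k + 1)"
    using assms by (cases \<pi>) (auto simp: cond2_from_Cons)
  with * cond2_from_nth(1)[OF this] show "\<pi> \<in> cond2_gap (k + 1) 0 2"
    by (auto simp: cond2_gap_def cond2_from_Cons)
next
  assume *: "\<pi> \<in> cond2_gap (k + 1) 0 2"
  then have mem: "\<pi> \<in> cond2_from (k + 1)" by (simp add: cond2_gap_def)
  have "(k + \<pi> ! 0 + \<pi> ! 1) mod 3 = 2" if "1 < length \<pi>" "\<pi> ! 1 \<le> k + 1"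
  proof -
    have "k + 1 \<le> \<pi> ! 0" "\<pi> ! 0 \<le> \<pi> ! 1"
      using that(1) by (auto intro!: cond2_from_nth[OF mem] simp del: One_nat_def)
    with that(2) have "\<pi> ! 0 = k + 1" "\<pi> ! 1 = k + 1" by linarith+
    then show ?thesis by presburger
  qed
  with * mem show "k # \<pi> \<in> cond2_from k"
    by (auto simp: cond2_from_Cons cond2_gap_def intro: cond2_from_mono)
qed

text \<open>After k, k a third part k or k + 1 gives the sum 3k or 3k + 1, never 2 modulo 3, so the
  rest starts at k + 2 or later. The gap at the first k then forces \<open>\<pi> ! 1\<close> to be
  at least k + 3, and the gap at the second k follows by monotonicity.\<close>

lemma Cons_Cons_cond2_from_iff:
  "k # k # \<pi> \<in> cond2_from k \<longleftrightarrow> \<pi> \<in> cond2_gap (k + 2) 1 0"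
proof
  assume *: "k # k # \<pi> \<in> cond2_from k"
  have "k + 2 \<le> \<pi> ! 0" if "\<pi> \<noteq> []"
  proof (rule ccontr)
    assume "\<not> k + 2 \<le> \<pi> ! 0"
    moreover have "k \<le> \<pi> ! 0" using * that cond2_from_nth(1)[of \<pi> k] by (simp add: cond2_from_Cons)
    ultimately have "\<pi> ! 0 = k \<or> \<pi> ! 0 = k + 1" by linarith
    moreover have "(k + k + \<pi> ! 0) mod 3 = 2"
      using * that calculation by (auto simp: cond2_from_Cons)
    ultimately show False by presburger
  qed
  then have "\<pi> \<in> cond2_from (k + 2)"
    using * by (cases \<pi>) (auto simp: cond2_from_Cons)
  moreover have "k + 3 \<le> \<pi> ! 1" if "1 < length \<pi>"
    using * that by (simp add: cond2_from_Cons numeral_2_eq_2)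
  ultimately show "\<pi> \<in> cond2_gap (k + 2) 1 0"
    using cond2_from_nth(1)[of \<pi> "k + 2" 2] by (auto simp: cond2_gap_def)
next
  assume *: "\<pi> \<in> cond2_gap (k + 2) 1 0"
  then have mem: "\<pi> \<in> cond2_from (k + 2)" by (simp add: cond2_gap_def)
  have le: "k + 2 \<le> \<pi> ! 0" if "\<pi> \<noteq> []" using cond2_from_nth(1)[OF mem] that by simp
  have "k + 3 \<le> \<pi> ! 1" if "1 < length \<pi>" using * that by (simp add: cond2_gap_def)
  moreover have "k + 3 \<le> \<pi> ! 2" if "2 < length \<pi>"
    using calculation that cond2_from_nth(2)[OF mem, of 1 2] by auto
  moreover have "\<pi> \<in> cond2_from k" using mem by (rule cond2_from_mono) simp
  ultimately show "k # k # \<pi> \<in> cond2_from k"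
    using le by (auto simp: cond2_from_Cons nth_Cons')
qed

section \<open>Decompositions by the multiplicity of the smallest admissible part\<close>

lemma cond2_from_split_twice:
  "cond2_from k = cond2_gap k 1 0 \<union> (\<lambda>\<pi>. k # k # \<pi>) ` cond2_gap (k + 2) 1 0"
proof (intro equalityI subsetI)
  fix \<pi> assume *: "\<pi> \<in> cond2_from k"
  show "\<pi> \<in> cond2_gap k 1 0 \<union> (\<lambda>\<pi>. k # k # \<pi>) ` cond2_gap (k + 2) 1 0"
  proof (cases "1 < length \<pi> \<and> \<pi> ! 1 = k")
    case True
    then obtain p \<rho> where \<pi>: "\<pi> = p # k # \<rho>" by (cases \<pi>; cases "tl \<pi>") auto
    with * have "p = k" by (auto simp: cond2_from_Cons)
    with * \<pi> show ?thesis by (simp add: Cons_Cons_cond2_from_iff)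
  next
    case False
    with * cond2_from_nth(1)[OF *, of 1] cond2_from_nth(1)[OF *, of 2] show ?thesis
      by (auto simp: cond2_gap_def)
  qed
next
  fix \<pi> assume "\<pi> \<in> cond2_gap k 1 0 \<union> (\<lambda>\<pi>. k # k # \<pi>) ` cond2_gap (k + 2) 1 0"
  then show "\<pi> \<in> cond2_from k"
    by (auto simp: cond2_gap_def[of k "Suc 0" 0] Cons_Cons_cond2_from_iff simp del: add_2_eq_Suc')
qed

text \<open>Restricts the preceding decomposition to third part at least k + 2. In
  \<open>k # k # \<pi>\<close> the third part is \<open>\<pi> ! 0\<close>, which is at least k + 2
  already, so the second piece survives whole.\<close>

lemma cond2_gap_0_2_split:
  "cond2_gap k 0 2 = cond2_gap k 1 2 \<union> (\<lambda>\<pi>. k # k # \<pi>) ` cond2_gap (k + 2) 1 0"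
proof -
  define Q where "Q \<pi> \<longleftrightarrow> (2 < length \<pi> \<longrightarrow> k + 2 \<le> \<pi> ! 2)" for \<pi>
  have *: "Q (k # k # \<pi>)" if "\<pi> \<in> cond2_gap (k + 2) 1 0" for \<pi>
    using cond2_from_nth(1)[of \<pi> "k + 2" 0] that by (simp add: Q_def cond2_gap_def)
  have "cond2_gap k 0 2 = {\<pi> \<in> cond2_from k. Q \<pi>}"
    using cond2_from_nth(1)[of _ k 1] by (auto simp: cond2_gap_def Q_def)
  also have "\<dots> = {\<pi> \<in> cond2_gap k 1 0. Q \<pi>} \<union> (\<lambda>\<pi>. k # k # \<pi>) ` cond2_gap (k + 2) 1 0"
    by (subst cond2_from_split_twice) (use * in blast)
  also have "{\<pi> \<in> cond2_gap k 1 0. Q \<pi>} = cond2_gap k 1 2"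
    by (auto simp: cond2_gap_def Q_def)
  finally show ?thesis .
qed

text \<open>A single copy of k leaves a tail of larger parts, which is the hypothesis of
  \<open>Cons_cond2_from_iff\<close>; otherwise all parts start from k + 1.\<close>

lemma cond2_gap_1_0_split:
  "cond2_gap k 1 0 = cond2_from (k + 1) \<union> (#) k ` cond2_gap (k + 1) 0 2"
proof (intro equalityI subsetI)
  fix \<pi> assume *: "\<pi> \<in> cond2_gap k 1 0"
  show "\<pi> \<in> cond2_from (k + 1) \<union> (#) k ` cond2_gap (k + 1) 0 2"
  proof (cases \<pi>)
    case (Cons p \<rho>)
    show ?thesis
    proof (cases "p = k")
      case True
      with * Cons have "\<rho> \<noteq> [] \<longrightarrow> k < \<rho> ! 0" "k # \<rho> \<in> cond2_from k"
        by (auto simp: cond2_gap_def)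
      with Cons_cond2_from_iff True Cons show ?thesis by blast
    next
      case False
      with * Cons show ?thesis by (simp add: cond2_gap_def cond2_from_Cons)
    qed
  qed simp
next
  fix \<pi> assume "\<pi> \<in> cond2_from (k + 1) \<union> (#) k ` cond2_gap (k + 1) 0 2"
  then show "\<pi> \<in> cond2_gap k 1 0"
  proof
    assume *: "\<pi> \<in> cond2_from (k + 1)"
    with cond2_from_nth(1)[OF *, of 1] cond2_from_nth(1)[OF *, of 2] cond2_from_mono[OF *, of k]
    show ?thesis by (auto simp: cond2_gap_def)
  next
    assume "\<pi> \<in> (#) k ` cond2_gap (k + 1) 0 2"
    then obtain \<rho> where \<rho>: "\<pi> = k # \<rho>" "\<rho> \<in> cond2_gap (k + 1) 0 2" by blast
    then have mem: "\<rho> \<in> cond2_from (k + 1)" by (simp add: cond2_gap_def)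
    from \<rho> cond2_from_nth(1)[OF mem, of 0] have "\<pi> \<in> cond2_from k"
      by (subst \<rho>(1), subst Cons_cond2_from_iff) auto
    with \<rho> cond2_from_nth(1)[OF mem, of 0] cond2_from_nth(1)[OF mem, of 1] show ?thesis
      by (auto simp: cond2_gap_def)
  qed
qed

text \<open>Three parts k + 1 have sum 3k + 3, which the congruence excludes, so the bound on the
  third part is automatic when k is absent. When k is present the bound falls on the second part of
  the tail and reads (k + 1) + 1, turning a = 0 into a = 1.\<close>

lemma cond2_gap_1_2_split:
  "cond2_gap k 1 2 = cond2_from (k + 1) \<union> (#) k ` cond2_gap (k + 1) 1 2"
proof -
  define Q where "Q \<pi> \<longleftrightarrow> (2 < length \<pi> \<longrightarrow> k + 2 \<le> \<pi> ! 2)" for \<pi>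
  have "cond2_gap k 1 2 = {\<pi> \<in> cond2_gap k 1 0. Q \<pi>}"
    by (auto simp: cond2_gap_def Q_def)
  also have "\<dots> = {\<pi> \<in> cond2_from (k + 1). Q \<pi>} \<union> (#) k ` {\<pi> \<in> cond2_gap (k + 1) 0 2. Q (k # \<pi>)}"
    by (subst cond2_gap_1_0_split) blast
  also have "{\<pi> \<in> cond2_from (k + 1). Q \<pi>} = cond2_from (k + 1)"
  proof -
    have "Q \<pi>" if "\<pi> \<in> cond2_from (k + 1)" for \<pi>
    proof (rule ccontr)
      assume "\<not> Q \<pi>"
      then obtain x y z \<rho> where \<pi>: "\<pi> = x # y # z # \<rho>" "z \<le> k + 1"
        by (cases \<pi>; cases "tl \<pi>"; cases "tl (tl \<pi>)") (auto simp: Q_def)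
      with that have "x = k + 1" "y = k + 1" "z = k + 1" "(x + y + z) mod 3 = 2"
        by (auto simp: cond2_from_Cons)
      then show False by presburger
    qed
    then show ?thesis by blast
  qed
  also have "{\<pi> \<in> cond2_gap (k + 1) 0 2. Q (k # \<pi>)} = cond2_gap (k + 1) 1 2"
    by (auto simp: cond2_gap_def Q_def)
  finally show ?thesis .
qed

section \<open>Translating all parts\<close>

lemma map_add_cond2_from_iff: "map ((+) j) \<pi> \<in> cond2_from (k + j) \<longleftrightarrow> \<pi> \<in> cond2_from k"
proof (induction \<pi> arbitrary: k)
  case (Cons p \<pi>)
  \<comment> \<open>Translation adds 3j to a sum of three parts, invisible modulo 3; the other
    conditions compare parts with each other or with k.\<close>
  have "(j + p + (j + a) + (j + b)) mod 3 = (p + a + b) mod 3" for a b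
    by presburger
  moreover have "map ((+) j) \<pi> \<in> cond2_from (j + p) \<longleftrightarrow> \<pi> \<in> cond2_from p"
    using Cons[of p] by (simp only: add.commute[of p j])
  moreover have "1 < length \<pi> \<Longrightarrow> 0 < length \<pi>" by linarith
  ultimately show ?case
    by (simp add: cond2_from_Cons cong: conj_cong imp_cong)
qed simp

lemma map_add_cond2_gap: "map ((+) j) ` cond2_gap k a b = cond2_gap (k + j) a b"
proof -
  have iff: "map ((+) j) \<pi> \<in> cond2_gap (k + j) a b \<longleftrightarrow> \<pi> \<in> cond2_gap k a b" for \<pi>
    by (auto simp: cond2_gap_def map_add_cond2_from_iff)
  show ?thesis
  proof (intro equalityI subsetI)
    fix \<pi> assume *: "\<pi> \<in> cond2_gap (k + j) a b"
    \<comment> \<open>The truncated subtraction is exact because every part is at least k +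
      j.\<close>
    then have "map ((+) j) (map (\<lambda>p. p - j) \<pi>) = \<pi>"
      by (auto simp: cond2_gap_def cond2_from_def intro!: map_idI)
    with * iff[of "map (\<lambda>p. p - j) \<pi>"] show "\<pi> \<in> map ((+) j) ` cond2_gap k a b"
      by (metis imageI)
  qed (use iff in blast)
qed

text \<open>In a sorted list bounded below by k the copies of k come first, so the second entry
  decides.\<close>

lemma count_list_le_one_iff:
  fixes k :: nat
  assumes "sorted \<pi>" "\<forall>p\<in>set \<pi>. k \<le> p"
  shows "count_list \<pi> k \<le> 1 \<longleftrightarrow> (1 < length \<pi> \<longrightarrow> k + 1 \<le> \<pi> ! 1)"
proof (cases "1 < length \<pi>")
  case True
  then obtain a b \<rho> where \<pi>: "\<pi> = a # b # \<rho>" by (cases \<pi>; cases "tl \<pi>") auto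
  show ?thesis
  proof (cases "b = k")
    case False
    with \<pi> assms have "count_list \<rho> k = 0" by (intro count_notin) auto
    with False \<pi> assms show ?thesis by simp
  qed (use \<pi> assms in auto)
next
  case False
  then show ?thesis by (cases \<pi>) auto
qed

lemma P_set_eq: "P_set = cond2_gap 2 1 0"
proof -
  have "\<pi> \<in> P_set \<longleftrightarrow> \<pi> \<in> cond2_from 2 \<and>
      count_list \<pi> 2 \<le> 1" for \<pi>
    unfolding P_set_def partitions_def cond2_from_def mem_Collect_eq
    by (meson order.strict_trans2 zero_less_numeral)
  moreover have "\<pi> \<in> cond2_gap 2 1 0 \<longleftrightarrow> \<pi> \<in> cond2_from 2 \<and>
      (1 < length \<pi> \<longrightarrow> 2 + 1 \<le> \<pi> ! 1)" for \<pi>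
    using cond2_from_nth(1)[of \<pi> 2 2] unfolding cond2_gap_def by auto
  moreover have "\<pi> \<in> cond2_from 2 \<Longrightarrow> sorted \<pi> \<and> (\<forall>p\<in>set \<pi>. 2 \<le> p)" for \<pi>
    by (simp add: cond2_from_def)
  ultimately have "\<pi> \<in> P_set \<longleftrightarrow> \<pi> \<in> cond2_gap 2 1 0" for \<pi>
    using count_list_le_one_iff[of \<pi> 2] by meson
  then show ?thesis by (rule set_eqI)
qed

section \<open>q-difference equations\<close>

definition dilate :: "'a::comm_ring_1 \<Rightarrow> 'a fps \<Rightarrow> 'a fps" where
  "dilate c F = fps_compose F (fps_const c * fps_X)"

lemma dilate_nth [simp]: "dilate c F $ n = c ^ n * F $ n"
  by (simp add: dilate_def)

lemma dilate_mult: "dilate c (F * G) = dilate c F * dilate c (G :: 'a::idom fps)"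
  by (simp add: dilate_def fps_compose_mult_distrib)

lemma dilate_dilate: "dilate c (dilate d F) = dilate (c * d) F"
  by (simp add: fps_eq_iff power_mult_distrib mult_ac)

lemma dilate_add: "dilate c (F + G) = dilate c F + dilate c G"
  and dilate_diff: "dilate c (F - G) = dilate c F - dilate c G"
  by (simp_all add: fps_eq_iff algebra_simps)

lemma dilate_fps_const_mult: "dilate c (fps_const b * F) = fps_const b * dilate c F"
  by (simp add: fps_eq_iff mult_ac)

lemma dilate_fps_X_power_mult:
  "dilate c (fps_X ^ d * F) = fps_const (c ^ d) * fps_X ^ d * dilate c F"
  by (simp add: fps_eq_iff mult.assoc fps_X_power_mult_nth)
    (metis le_add_diff_inverse linorder_not_less mult.assoc power_add)

text \<open>The series of \<open>t i\<close> z^(\<open>w i\<close>) in an auxiliary outer variable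
  z. An infinite fibre would contribute the default value 0, hence the finiteness hypotheses in
  later lemmas.\<close>

definition gf :: "('i \<Rightarrow> nat) \<Rightarrow> ('i \<Rightarrow> 'a::comm_ring_1) \<Rightarrow> 'a fps" where
  "gf w t = Abs_fps (\<lambda>n. \<Sum>i | w i = n. t i)"

lemma gf_nth: "gf w t $ n = (\<Sum>i | w i = n. t i)"
  by (simp add: gf_def)

lemma finite_fibre_prod:
  fixes v :: "'i \<Rightarrow> nat" and w :: "'j \<Rightarrow> nat"
  assumes "\<And>n. finite {i. v i = n}" "\<And>n. finite {j. w j = n}"
  shows "finite {p. (case p of (i, j) \<Rightarrow> v i + w j) = n}"
proof (rule finite_subset)
  show "{p. (case p of (i, j) \<Rightarrow> v i + w j) = n} \<subseteq>
      (\<Union>m\<le>n. {i. v i = m}) \<times> (\<Union>m\<le>n. {j. w j = m})"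
    by auto
  show "finite \<dots>" using assms by (intro finite_cartesian_product finite_UN_I) auto
qed

lemma gf_mult:
  fixes v :: "'i \<Rightarrow> nat" and w :: "'j \<Rightarrow> nat"
  assumes "\<And>n. finite {i. v i = n}" "\<And>n. finite {j. w j = n}"
  shows "gf v s * gf w t = gf (\<lambda>(i, j). v i + w j) (\<lambda>(i, j). s i * t j)"
proof (rule fps_ext)
  fix n
  have "(gf v s * gf w t) $ n = (\<Sum>m=0..n. \<Sum>p\<in>{i. v i = m} \<times> {j. w j = n - m}. s (fst p) * t (snd p))"
    by (simp add: fps_mult_nth gf_nth sum_product sum.cartesian_product case_prod_unfold)
  also have "\<dots> = (\<Sum>p\<in>(\<Union>m\<in>{0..n}. {i. v i = m} \<times> {j. w j = n - m}). s (fst p) * t (snd p))"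
    using assms by (intro sum.UNION_disjoint [symmetric]) (auto intro: finite_cartesian_product)
  also have "(\<Union>m\<in>{0..n}. {i. v i = m} \<times> {j. w j = n - m}) = {p. (case p of (i, j) \<Rightarrow> v i + w j) = n}"
    by auto
  finally show "(gf v s * gf w t) $ n = gf (\<lambda>(i, j). v i + w j) (\<lambda>(i, j). s i * t j) $ n"
    by (simp add: gf_nth case_prod_unfold)
qed

lemma gf_scaled_nth:
  assumes "d > 0"
  shows "gf (\<lambda>k. d * k) t $ n = (if d dvd n then t (n div d) else 0)"
proof (cases "d dvd n")
  case True
  then have "{k. d * k = n} = {n div d}" using assms by auto
  with True show ?thesis by (simp add: gf_nth)
next
  case False
  then have "{k. d * k = n} = {}" by auto
  with False show ?thesis by (simp add: gf_nth)
qed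

lemma finite_scaled_fibre: "d > 0 \<Longrightarrow> finite {k :: nat. d * k = n}"
  by (rule finite_subset[of _ "{n div d}"]) auto

text \<open>The coefficient of z^(d(k+1)) in G(z) - G(qz) carries the factor 1 - q^(d(k+1)), which
  cancels the last factor of (q^d; q^d)_(k+1). Both of Euler's identities come from this: one with s
  = t, the other with s belonging to a dilate of the series.\<close>

lemma gf_scaled_recurrence:
  assumes "d > 0" "\<And>k. t (Suc k) * (1 - q ^ (d * Suc k)) = c * s k"
  shows "gf (\<lambda>k. d * k) t - dilate q (gf (\<lambda>k. d * k) t) = fps_const c * fps_X ^ d * gf (\<lambda>k. d * k) s"
proof (rule fps_ext)
  fix n
  consider "\<not> d dvd n" | "n = 0" | k where "n = d * Suc k"
    by (metis dvdE mult_0_right not0_implies_Suc)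
  then show "(gf (\<lambda>k. d * k) t - dilate q (gf (\<lambda>k. d * k) t)) $ n =
      (fps_const c * fps_X ^ d * gf (\<lambda>k. d * k) s) $ n"
  proof cases
    case 1
    then have "d \<le> n \<Longrightarrow> \<not> d dvd (n - d)" using dvd_minus_self by auto
    with 1 assms(1) show ?thesis
      by (simp add: gf_scaled_nth mult.assoc fps_X_power_mult_nth)
  next
    case 2
    with assms(1) show ?thesis by (simp add: gf_scaled_nth mult.assoc fps_X_power_mult_nth)
  next
    case 3
    have "t (Suc k) - q ^ (d * Suc k) * t (Suc k) = c * s k"
      using assms(2)[of k] by (simp only: algebra_simps mult_1_left)
    with 3 assms(1) show ?thesis
      by (simp add: gf_scaled_nth mult.assoc fps_X_power_mult_nth)
  qed
qed

lemma dilate_gf_scaled: "dilate q (gf (\<lambda>k. d * k) t) = gf (\<lambda>k. d * k) (\<lambda>k. q ^ (d * k) * t k)"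
  by (rule fps_ext) (auto simp: gf_nth sum_distrib_left intro!: sum.cong)

section \<open>Inserting q^(n(n-1)/2) into the coefficients, and the q-difference equation\<close>

definition binom_twist :: "'a::comm_ring_1 \<Rightarrow> 'a fps \<Rightarrow> 'a fps" where
  "binom_twist q F = Abs_fps (\<lambda>n. q ^ (n choose 2) * F $ n)"

lemma binom_twist_nth [simp]: "binom_twist q F $ n = q ^ (n choose 2) * F $ n"
  by (simp add: binom_twist_def)

lemma choose_two_add: "(m + n) choose 2 = (m choose 2) + (n choose 2) + m * n"
  by (induction m) (simp_all add: numeral_2_eq_2)

text \<open>The cross term r(n - r) in the splitting of n choose 2 acts as dilation by q^r; this is
  how a plain factor x^r produces a shifted argument.\<close>

lemma binom_twist_fps_X_power_mult:
  "binom_twist q (fps_X ^ r * F) =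
     fps_const (q ^ (r choose 2)) * fps_X ^ r * dilate (q ^ r) (binom_twist q F)"
proof (rule fps_ext)
  fix n
  have "q ^ (n choose 2) = q ^ (r choose 2) * ((q ^ r) ^ (n - r) * q ^ ((n - r) choose 2))" if "r \<le> n"
    using choose_two_add[of r "n - r"] that by (simp flip: power_add power_mult add: ac_simps)
  then show "binom_twist q (fps_X ^ r * F) $ n =
      (fps_const (q ^ (r choose 2)) * fps_X ^ r * dilate (q ^ r) (binom_twist q F)) $ n"
    by (simp add: mult.assoc fps_X_power_mult_nth)
qed

lemma binom_twist_dilate: "binom_twist q (dilate c F) = dilate c (binom_twist q F)"
  by (simp add: fps_eq_iff mult_ac)

lemma binom_twist_add: "binom_twist q (F + G) = binom_twist q F + binom_twist q G"
  and binom_twist_diff: "binom_twist q (F - G) = binom_twist q F - binom_twist q G"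
  and binom_twist_fps_const_mult: "binom_twist q (fps_const c * F) = fps_const c * binom_twist q F"
  by (simp_all add: fps_eq_iff algebra_simps)

definition qdiff_solution :: "'a::comm_ring_1 \<Rightarrow> 'a fps \<Rightarrow> bool" where
  "qdiff_solution q F \<longleftrightarrow>
     F = dilate q F + fps_const (q^2) * fps_X * dilate q F
       + (fps_const (q^6) * fps_X^2 + fps_const (q^8) * fps_X^3) * dilate (q^3) F
       - fps_const (q^13) * fps_X^4 * dilate (q^4) F"

lemma qdiff_solution_unique:
  fixes q :: "'a::idom"
  assumes "qdiff_solution q F" "qdiff_solution q G" "F $ 0 = G $ 0" "\<And>n. n > 0 \<Longrightarrow> q ^ n \<noteq> 1"
  shows "F = G"
proof -
  define D where "D = F - G"
  have D: "D = dilate q D + fps_const (q^2) * (fps_X^1 * dilate q D)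
       + fps_const (q^6) * (fps_X^2 * dilate (q^3) D) + fps_const (q^8) * (fps_X^3 * dilate (q^3) D)
       - fps_const (q^13) * (fps_X^4 * dilate (q^4) D)"
    using arg_cong2[where f = "(-)", OF assms(1)[unfolded qdiff_solution_def]
        assms(2)[unfolded qdiff_solution_def]]
    unfolding D_def dilate_diff by (simp only: algebra_simps power_one_right)
  have "D $ n = 0" for n
  proof (induction n rule: less_induct)
    case (less n)
    show ?case
    proof (cases "n = 0")
      case False
      \<comment> \<open>Each term with a power of x contributes a coefficient of index below n, zero
        by induction; only \<open>dilate q D\<close> survives.\<close>
      have "D $ n = q ^ n * D $ n"
        using arg_cong[OF D, of "\<lambda>D. D $ n"] False less
        by (simp add: fps_X_power_mult_nth del: power_one_right cong: if_cong)
      then have "(1 - q ^ n) * D $ n = 0" by (simp add: algebra_simps)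
      with assms(4)[of n] False show ?thesis by simp
    qed (simp add: D_def assms(3))
  qed
  then show ?thesis by (simp add: D_def fps_eq_iff)
qed

lemma qdiff_solution_binom_twist:
  fixes q :: "'a::idom"
  assumes "(1 - fps_const (q^2) * fps_X) * (1 - fps_const (q^5) * fps_X^3) * H =
     (1 + fps_const (q^5) * fps_X^2) * dilate q H"
  shows "qdiff_solution q (binom_twist q H)"
proof -
  \<comment> \<open>Twisting x, x^3, x^4 on the left adds 0, 3, 6 to the exponents 2, 5, 7, giving
    2, 8, 13. On the right x^2 adds 1 to 5, and its dilation by q^2 composes with the one by q to
    q^3.\<close>
  have "H - fps_const (q^2) * (fps_X^1 * H) - fps_const (q^5) * (fps_X^3 * H)
      + fps_const (q^7) * (fps_X^4 * H) = dilate q H + fps_const (q^5) * (fps_X^2 * dilate q H)"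
    using assms by (simp add: algebra_simps power_numeral_reduce fps_const_mult[symmetric] del: fps_const_mult)
  from arg_cong[OF this, of "binom_twist q"] show ?thesis
    unfolding binom_twist_add binom_twist_diff binom_twist_fps_const_mult binom_twist_fps_X_power_mult
      binom_twist_dilate dilate_dilate qdiff_solution_def
    by (simp add: algebra_simps choose_two power_numeral_reduce fps_const_mult[symmetric] del: fps_const_mult)
qed

section \<open>Generating functions of partitions\<close>

text \<open>The outer variable marks the number of parts and the inner one the size, the reverse of
  the nesting in the theorem, so that dilation acts on the former.\<close>

definition partition_gf :: "nat list set \<Rightarrow> 'a::comm_ring_1 fps fps" where
  "partition_gf A = Abs_fps (\<lambda>m. Abs_fps (\<lambda>n. of_nat (card {\<pi> \<in> A. length \<pi> = m \<and> sum_list \<pi> = n})))"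

lemma partition_gf_nth:
  "partition_gf A $ m $ n = of_nat (card {\<pi> \<in> A. length \<pi> = m \<and> sum_list \<pi> = n})"
  by (simp add: partition_gf_def)

lemma finite_lists_length_sum: "finite {\<pi> \<in> A. length \<pi> = m \<and> sum_list \<pi> = (n :: nat)}"
proof (rule finite_subset)
  show "{\<pi> \<in> A. length \<pi> = m \<and> sum_list \<pi> = n} \<subseteq> {\<pi>. set \<pi> \<subseteq> {..n} \<and> length \<pi> = m}"
    using member_le_sum_list by fastforce
  show "finite \<dots>" by (intro finite_lists_length_eq) simp
qed

lemma partition_gf_Un:
  assumes "A \<inter> B = {}"
  shows "partition_gf (A \<union> B) = partition_gf A + partition_gf B"
proof -
  have "card {\<pi> \<in> A \<union> B. length \<pi> = m \<and> sum_list \<pi> = n} =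
      card {\<pi> \<in> A. length \<pi> = m \<and> sum_list \<pi> = n} + card {\<pi> \<in> B. length \<pi> = m \<and> sum_list \<pi> = n}" for m n
    using assms by (subst card_Un_disjoint[symmetric])
      (auto simp: finite_lists_length_sum intro!: arg_cong[where f = card])
  then show ?thesis by (simp add: fps_eq_iff partition_gf_nth)
qed

text \<open>Adding a new parts, c to each old part and b on top of that turns F(x) into q^b x^a
  F(q^c x). This covers translation as well as prepending one or two copies of k.\<close>

lemma partition_gf_image:
  assumes "inj f" and len: "\<And>\<pi>. length (f \<pi>) = a + length \<pi>"
    and sum: "\<And>\<pi>. sum_list (f \<pi>) = b + c * length \<pi> + sum_list \<pi>"
  shows "partition_gf (f ` A) = fps_const (fps_X ^ b) * fps_X ^ a * dilate (fps_X ^ c) (partition_gf A)"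
proof -
  have "card {\<pi> \<in> f ` A. length \<pi> = m \<and> sum_list \<pi> = n} =
      (if a \<le> m \<and> b + c * (m - a) \<le> n
       then card {\<pi> \<in> A. length \<pi> = m - a \<and> sum_list \<pi> = n - (b + c * (m - a))} else 0)" for m n
  proof -
    have "{\<pi> \<in> f ` A. length \<pi> = m \<and> sum_list \<pi> = n} =
        f ` {\<pi> \<in> A. a + length \<pi> = m \<and> b + c * length \<pi> + sum_list \<pi> = n}"
      using len sum by auto
    also have "card \<dots> = card {\<pi> \<in> A. a + length \<pi> = m \<and> b + c * length \<pi> + sum_list \<pi> = n}"
      using \<open>inj f\<close> by (intro card_image) (auto intro: inj_on_subset)
    also have "{\<pi> \<in> A. a + length \<pi> = m \<and> b + c * length \<pi> + sum_list \<pi> = n} =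
        (if a \<le> m \<and> b + c * (m - a) \<le> n
         then {\<pi> \<in> A. length \<pi> = m - a \<and> sum_list \<pi> = n - (b + c * (m - a))} else {})"
      by auto
    finally show ?thesis by auto
  qed
  note card = this
  have nth: "(fps_const (fps_X ^ b) * fps_X ^ a * dilate (fps_X ^ c) F) $ m =
      (if a \<le> m then fps_X ^ (b + c * (m - a)) * F $ (m - a) else 0)" for F :: "'a fps fps" and m
    by (simp add: mult.assoc fps_X_power_mult_nth power_add power_mult)
  show ?thesis
    by (intro fps_ext) (simp add: partition_gf_nth nth fps_X_power_mult_nth card)
qed

lemma partition_gf_cond2_gap_add:
  "partition_gf (cond2_gap (k + j) a b) = dilate (fps_X ^ j) (partition_gf (cond2_gap k a b))"
proof -
  have "sum_list (map ((+) j) \<pi>) = j * length \<pi> + sum_list \<pi>" for \<pi>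
    by (induction \<pi>) auto
  then show ?thesis
    using partition_gf_image[of "map ((+) j)" 0 0 j "cond2_gap k a b"]
    by (simp add: map_add_cond2_gap)
qed

lemma cond2_from_eq_cond2_gap: "cond2_from k = cond2_gap k 0 0"
  using cond2_from_nth(1)[of _ k] by (auto simp: cond2_gap_def)

lemma partition_gf_Cons:
  "partition_gf ((#) k ` A) = fps_const (fps_X ^ k) * fps_X * partition_gf A"
  using partition_gf_image[of "(#) k" 1 k 0 A] by (simp add: dilate_def)

lemma partition_gf_Cons_Cons:
  "partition_gf ((\<lambda>\<pi>. k # k # \<pi>) ` A) = fps_const (fps_X ^ (2 * k)) * fps_X ^ 2 * partition_gf A"
  using partition_gf_image[of "\<lambda>\<pi>. k # k # \<pi>" 2 "2 * k" 0 A] by (simp add: dilate_def inj_def)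

lemma qdiff_solution_partition_gf:
  "qdiff_solution fps_X (partition_gf P_set :: 'a::idom fps fps)"
proof -
  let ?x = "fps_X :: 'a fps fps" and ?q = "\<lambda>n. fps_const (fps_X ^ n) :: 'a fps fps"
  let ?D = "\<lambda>j. dilate (fps_X ^ j) :: 'a fps fps \<Rightarrow> _"
  \<comment> \<open>F belongs to the class of the theorem, S to the unrestricted one, T to the bound
    b = 2, U to both bounds. Classes starting at 3 or 4 are dilates of these, so four equations
    close the system.\<close>
  define F where "F = (partition_gf (cond2_gap 2 1 0) :: 'a fps fps)"
  define S where "S = (partition_gf (cond2_gap 2 0 0) :: 'a fps fps)"
  define T where "T = (partition_gf (cond2_gap 2 0 2) :: 'a fps fps)"
  define U where "U = (partition_gf (cond2_gap 2 1 2) :: 'a fps fps)"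
  have shift: "partition_gf (cond2_gap (2 + j) a b) = ?D j (partition_gf (cond2_gap 2 a b))" for j a b
    by (rule partition_gf_cond2_gap_add)
  have not2: "cond2_from 3 \<inter> (#) 2 ` A = {}" for A
    by (auto simp: cond2_from_Cons)
  have S: "S = F + ?q 4 * ?x^2 * ?D 2 F"
    unfolding S_def F_def shift[symmetric] unfolding cond2_from_eq_cond2_gap[symmetric]
    by (subst cond2_from_split_twice, subst partition_gf_Un)
      (auto simp: partition_gf_Cons_Cons cond2_gap_def)
  have F: "F = ?D 1 S + ?q 2 * ?x * ?D 1 T"
    unfolding S_def F_def T_def shift[symmetric] unfolding cond2_from_eq_cond2_gap[symmetric]
    by (subst cond2_gap_1_0_split, subst partition_gf_Un) (simp_all add: partition_gf_Cons not2)
  have T: "T = U + ?q 4 * ?x^2 * ?D 2 F"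
    unfolding T_def U_def F_def shift[symmetric]
    by (subst cond2_gap_0_2_split, subst partition_gf_Un)
      (auto simp: partition_gf_Cons_Cons cond2_gap_def)
  have U: "U = ?D 1 S + ?q 2 * ?x * ?D 1 U"
    unfolding S_def U_def shift[symmetric] unfolding cond2_from_eq_cond2_gap[symmetric]
    by (subst cond2_gap_1_2_split, subst partition_gf_Un) (simp_all add: partition_gf_Cons not2)
  have DF: "?D i (?D j F) = ?D (i + j) F" for i j
    by (simp add: dilate_dilate power_add)
  have D1: "?D 1 (?q n * ?x^r * G) = ?q (n + r) * ?x^r * ?D 1 G" for n r G
    by (simp add: mult.assoc dilate_fps_const_mult dilate_fps_X_power_mult power_add)
  have DS: "?D 1 S = ?D 1 F + ?q 6 * ?x^2 * ?D 3 F"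
    by (subst S) (simp only: dilate_add D1 DF, simp del: One_nat_def)
  have DT: "?D 1 T = ?D 1 U + ?q 6 * ?x^2 * ?D 3 F"
    by (subst T) (simp only: dilate_add D1 DF, simp del: One_nat_def)
  have q: "?q 2 * ?q 6 = ?q 8" "?q 2 * ?q 11 = ?q 13"
    by (simp_all flip: power_add)
  \<comment> \<open>The equations for U and F differ only in \<open>?D 1 U\<close> against
    \<open>?D 1 T\<close>, and T - U is a multiple of a dilate of F. Subtracting expresses U through
    F alone.\<close>
  have elim_U: "u = f - c * x^3 * g"
    if "u = s + a * x * u'" "f = s + a * x * (u' + b * x^2 * g)" "a * b = c"
    for u f s a x u' b c g :: "'a fps fps"
    unfolding that(1,2) that(3)[symmetric] by (simp add: algebra_simps power_numeral_reduce)
  have "U = F - ?q 8 * ?x^3 * ?D 3 F"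
    using elim_U[OF U F[unfolded DT] q(1)] .
  then have DU: "?D 1 U = ?D 1 F - ?q 11 * ?x^3 * ?D 4 F"
    by (simp only: dilate_diff D1 DF, simp del: One_nat_def)
  \<comment> \<open>The letters f', g, h stand for F(xq), F(xq^3), F(xq^4); with them free, the last
    substitution is polynomial algebra.\<close>
  have elim: "f = f' + a * x * f' + (b * x^2 + c * x^3) * g - d * x^4 * h"
    if "f = (f' + b * x^2 * g) + a * x * (f' - e * x^3 * h + b * x^2 * g)" "a * b = c" "a * e = d"
    for f f' a x b c d e g h :: "'a fps fps"
    unfolding that(1) that(2,3)[symmetric] by (simp add: algebra_simps power_numeral_reduce)
  have "F = ?D 1 F + ?q 2 * ?x * ?D 1 F + (?q 6 * ?x^2 + ?q 8 * ?x^3) * ?D 3 F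
      - ?q 13 * ?x^4 * ?D 4 F"
    by (rule elim[OF F[unfolded DS DT DU] q])
  then show ?thesis
    unfolding qdiff_solution_def P_set_eq F_def by simp
qed

section \<open>The multisums\<close>

lemma has_sum_fpsI:
  fixes t :: "'i \<Rightarrow> 'a::comm_ring_1 fps"
  assumes "\<And>n. finite (B n)" "\<And>n. B n \<subseteq> A" "\<And>n i. i \<in> A - B n \<Longrightarrow> t i $ n = 0"
    and "\<And>n. (\<Sum>i\<in>B n. t i $ n) = S $ n"
  shows "(t has_sum S) A"
  unfolding has_sum_def tendsto_fps_iff eventually_finite_subsets_at_top
proof
  fix n
  \<comment> \<open>Coefficient n is constant on all finite sets beyond \<open>B n\<close>, which is
    what q-adic convergence asks for.\<close>
  have "sum t Y $ n = S $ n" if "finite Y" "B n \<subseteq> Y" "Y \<subseteq> A" for Y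
  proof -
    have "(\<Sum>i\<in>Y. t i $ n) = (\<Sum>i\<in>B n. t i $ n)"
      using that assms(3) by (intro sum.mono_neutral_right) auto
    then show ?thesis by (simp add: fps_sum_nth assms(4))
  qed
  then show "\<exists>X. finite X \<and> X \<subseteq> A \<and> (\<forall>Y. finite Y \<and> X \<subseteq> Y \<and> Y \<subseteq> A \<longrightarrow> sum t Y $ n = S $ n)"
    using assms(1,2) by (intro exI[of _ "B n"]) simp
qed

text \<open>Summing over m sets the auxiliary variable z to 1. No term of weight above n reaches
  q^n, so finitely many m suffice.\<close>

lemma has_sum_gf:
  fixes t :: "'i \<Rightarrow> 'a::comm_ring_1 fps"
  assumes fin: "\<And>m. finite {i. w i = m}" and zero: "\<And>i n. n < w i \<Longrightarrow> t i $ n = 0"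
    and S: "\<And>n. S $ n = (\<Sum>m\<le>n. gf w t $ m $ n)"
  shows "(t has_sum S) UNIV"
proof (rule has_sum_fpsI[where B = "\<lambda>n. \<Union>m\<le>n. {i. w i = m}"])
  fix n
  have "(\<Sum>i\<in>(\<Union>m\<le>n. {i. w i = m}). t i $ n) = (\<Sum>m\<le>n. \<Sum>i | w i = m. t i $ n)"
    using fin by (intro sum.UNION_disjoint) auto
  then show "(\<Sum>i\<in>(\<Union>m\<le>n. {i. w i = m}). t i $ n) = S $ n"
    by (simp add: S gf_nth fps_sum_nth)
qed (use fin zero in \<open>auto simp: not_le\<close>)

section \<open>Division by q-Pochhammer symbols and Euler's identities\<close>

lemma fps_mult_inverse_eq_1:
  fixes f :: "'b::field fps fps"
  assumes "f $ 0 = 1"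
  shows "inverse f * f = 1"
proof -
  \<comment> \<open>The coefficient ring \<open>'b fps\<close> is not a field; invertibility rests
    on the constant term 1.\<close>
  have "inverse f = fps_right_inverse f 1"
    by (subst fps_inverse_def) (simp add: assms)
  with fps_left_inverse'[of 1 f] assms show ?thesis by simp
qed

lemma fps_divide_eqI:
  fixes f g h :: "'b::field fps fps"
  assumes "f $ 0 = 1" "g = h * f"
  shows "g / f = h"
proof -
  have "g / f = h * (inverse f * f)"
    using assms fps_divide_unit'[of f g] by (simp add: subdegree_eq_0_iff mult_ac)
  with fps_mult_inverse_eq_1[OF assms(1)] show ?thesis by simp
qed

text \<open>Here q lives in the coefficients; in the series below, a bare \<open>fps_X\<close>
  beside it is the auxiliary outer variable z.\<close>

abbreviation (input) q_fps :: "'b::field fps fps" where "q_fps \<equiv> fps_X"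

definition inv_qpoch :: "nat \<Rightarrow> nat \<Rightarrow> 'b::field fps fps" where
  "inv_qpoch d k = inverse (qpoch (q_fps ^ d) (q_fps ^ d) k)"

lemma qpoch_nth_0: "d > 0 \<Longrightarrow> qpoch (q_fps ^ d) (q_fps ^ d) k $ 0 = 1"
  by (induction k) (simp_all add: qpoch_def power_0_left)

lemma inv_qpoch_mult: "d > 0 \<Longrightarrow> inv_qpoch d k * qpoch (q_fps ^ d) (q_fps ^ d) k = 1"
  by (simp add: inv_qpoch_def fps_mult_inverse_eq_1 qpoch_nth_0)

lemma inv_qpoch_0 [simp]: "inv_qpoch d 0 = 1"
  using fps_mult_inverse_eq_1[of 1] by (simp add: inv_qpoch_def qpoch_def)

lemma inv_qpoch_Suc:
  assumes "d > 0"
  shows "inv_qpoch d (Suc k) * (1 - q_fps ^ (d * Suc k)) = (inv_qpoch d k :: 'b::field fps fps)"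
proof -
  let ?P = "qpoch (q_fps ^ d) (q_fps ^ d) :: nat \<Rightarrow> 'b fps fps"
  have "?P (Suc k) = ?P k * (1 - q_fps ^ (d * Suc k))"
    by (simp add: qpoch_def power_add power_mult)
  then have "inv_qpoch d (Suc k) * (1 - q_fps ^ (d * Suc k)) =
      inv_qpoch d k * ?P k * (inv_qpoch d (Suc k) * (1 - q_fps ^ (d * Suc k)))"
    by (simp only: inv_qpoch_mult[OF assms] mult_1_left)
  also have "\<dots> = inv_qpoch d k * (inv_qpoch d (Suc k) * ?P (Suc k))"
    using \<open>?P (Suc k) = _\<close> by (simp only: mult_ac)
  finally show ?thesis by (simp only: inv_qpoch_mult[OF assms] mult_1_right)
qed

text \<open>By Euler the series is 1/(q^e z^d; q^d) with infinitely many factors, and z -> qz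
  removes the first of them. The functional equation stands in for the infinite product.\<close>

lemma gf_inv_qpoch_recurrence:
  assumes "d > 0"
  shows "(1 - fps_const (q_fps ^ e) * fps_X ^ d) * gf (\<lambda>k. d * k) (\<lambda>k. q_fps ^ (e * k) * inv_qpoch d k)
    = dilate q_fps (gf (\<lambda>k. d * k) (\<lambda>k. q_fps ^ (e * k) * inv_qpoch d k :: 'b::field fps fps))"
    (is "_ * ?A = _")
proof -
  have "?A - dilate q_fps ?A = fps_const (q_fps ^ e) * fps_X ^ d * ?A"
    using inv_qpoch_Suc[OF assms, where 'b='b]
    by (intro gf_scaled_recurrence assms) (simp add: power_add mult_ac)
  then show ?thesis by (simp add: algebra_simps)
qed

text \<open>Euler's other identity: the exponent is d k(k-1)/2 + r k up to a constant, so the series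
  is a multiple of the infinite product (-\<sigma> q^r z^d; q^d). The increment dk of the exponent
  is absorbed by the dilation.\<close>

lemma gf_theta_inv_qpoch_recurrence:
  assumes "d > 0" and e: "\<And>k. e (Suc k) = e k + d * k + r"
  shows "gf (\<lambda>k. d * k) (\<lambda>k. \<sigma> ^ k * q_fps ^ e k * inv_qpoch d k)
    = (1 + fps_const (\<sigma> * q_fps ^ r) * fps_X ^ d) *
      dilate q_fps (gf (\<lambda>k. d * k) (\<lambda>k. \<sigma> ^ k * q_fps ^ e k * inv_qpoch d k :: 'b::field fps fps))"
    (is "?A = _")
proof -
  have "\<sigma> ^ Suc k * q_fps ^ e (Suc k) * inv_qpoch d (Suc k) * (1 - q_fps ^ (d * Suc k)) =
      \<sigma> * q_fps ^ r * (q_fps ^ (d * k) * (\<sigma> ^ k * q_fps ^ e k * inv_qpoch d k))" for k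
    by (simp only: mult.assoc inv_qpoch_Suc[OF assms(1)] e power_add power_Suc) (simp only: mult_ac)
  from gf_scaled_recurrence[OF assms(1) this]
  show ?thesis unfolding dilate_gf_scaled[symmetric]
    by (simp only: diff_eq_eq distrib_right mult_1_left add.commute)
qed

section \<open>Passing from a functional equation to the partition series\<close>

lemma partition_gf_eq_binom_twist:
  assumes "(1 - fps_const (q_fps^2) * fps_X) * (1 - fps_const (q_fps^5) * fps_X^3) * H =
     (1 + fps_const (q_fps^5) * fps_X^2) * dilate q_fps H"
    and "H $ 0 = 1"
  shows "binom_twist q_fps H = (partition_gf P_set :: 'b::field fps fps fps)"
proof (rule qdiff_solution_unique)
  show "qdiff_solution q_fps (binom_twist q_fps H)" by (rule qdiff_solution_binom_twist) fact
  show "qdiff_solution q_fps (partition_gf P_set)" by (rule qdiff_solution_partition_gf)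
  have "{\<pi> \<in> P_set. length \<pi> = 0 \<and> sum_list \<pi> = n} = (if n = 0 then {[]} else {})" for n
    by (auto simp: P_set_eq cond2_gap_def)
  then show "binom_twist q_fps H $ 0 = partition_gf P_set $ 0"
    using assms(2) by (auto simp: fps_eq_iff partition_gf_nth numeral_2_eq_2)
  show "q_fps ^ n \<noteq> 1" if "n > 0" for n
    using that by (metis fps_one_nth fps_X_power_nth less_not_refl zero_neq_one)
qed

lemma length_le_sum_list:
  fixes \<pi> :: "nat list"
  assumes "\<forall>p\<in>set \<pi>. 0 < p"
  shows "length \<pi> \<le> sum_list \<pi>"
  using assms by (induction \<pi>) auto

text \<open>Positive parts keep the length at most the size, so only lengths m \<le> n meet q^n. The
  factor \<open>fps_X ^ m\<close> puts x in place of the variable marking the length.\<close>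

lemma P_set_has_sum:
  "((\<lambda>\<pi>. x_var ^ length \<pi> * q_var ^ sum_list \<pi>) has_sum
     Abs_fps (\<lambda>n. \<Sum>m\<le>n. fps_X ^ m * partition_gf P_set $ m $ n)) P_set"
proof (rule has_sum_fpsI[where B = "\<lambda>n. \<Union>m\<le>n. {\<pi> \<in> P_set. length \<pi> = m \<and> sum_list \<pi> = n}"])
  fix n :: nat
  let ?t = "\<lambda>\<pi>. x_var ^ length \<pi> * q_var ^ sum_list \<pi>"
  show "finite (\<Union>m\<le>n. {\<pi> \<in> P_set. length \<pi> = m \<and> sum_list \<pi> = n})"
    using finite_lists_length_sum by blast
  have nth: "?t \<pi> $ n = (if sum_list \<pi> = n then fps_X ^ length \<pi> else 0)" for \<pi>
    by (simp add: fps_const_power)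
  show "?t \<pi> $ n = 0" if "\<pi> \<in> P_set - (\<Union>m\<le>n. {\<pi> \<in> P_set. length \<pi> = m \<and> sum_list \<pi> = n})" for \<pi>
    using that length_le_sum_list[of \<pi>] by (auto simp: nth P_set_def partitions_def)
  have "(\<Sum>\<pi>\<in>(\<Union>m\<le>n. {\<pi> \<in> P_set. length \<pi> = m \<and> sum_list \<pi> = n}). ?t \<pi> $ n) =
      (\<Sum>m\<le>n. \<Sum>\<pi> | \<pi> \<in> P_set \<and> length \<pi> = m \<and> sum_list \<pi> = n. ?t \<pi> $ n)"
    by (intro sum.UNION_disjoint) (auto simp: finite_lists_length_sum)
  also have "\<dots> = (\<Sum>m\<le>n. fps_X ^ m * partition_gf P_set $ m $ n)"
    by (simp add: nth partition_gf_nth mult.commute)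
  finally show "(\<Sum>\<pi>\<in>(\<Union>m\<le>n. {\<pi> \<in> P_set. length \<pi> = m \<and> sum_list \<pi> = n}). ?t \<pi> $ n) =
      Abs_fps (\<lambda>n. \<Sum>m\<le>n. fps_X ^ m * partition_gf P_set $ m $ n) $ n"
    by simp
qed auto

text \<open>The shape \<open>q_var ^ e i * v i\<close> with \<open>w i \<le> e i\<close> certifies
  that a term of weight \<open>w i\<close> starts no earlier than q^(\<open>w i\<close>), which
  gives convergence. The functional equation and the constant term then identify the sum.\<close>

lemma has_sum_infsum_P_set:
  fixes w :: "'i \<Rightarrow> nat" and u :: "'i \<Rightarrow> rat fps fps"
  assumes fin: "\<And>m. finite {i. w i = m}"
    and u: "\<And>i. u i = q_var ^ e i * v i" "\<And>i. w i \<le> e i"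
    and H: "(1 - fps_const (q_var^2) * fps_X) * (1 - fps_const (q_var^5) * fps_X^3) * gf w u =
      (1 + fps_const (q_var^5) * fps_X^2) * dilate q_var (gf w u)"
    and "gf w u $ 0 = 1"
  shows "((\<lambda>i. x_var ^ w i * q_var ^ (w i choose 2) * u i) has_sum
    (\<Sum>\<^sub>\<infinity>\<pi>\<in>P_set. x_var ^ length \<pi> * q_var ^ sum_list \<pi>)) UNIV"
proof (rule has_sum_gf[OF fin])
  show "(x_var ^ w i * q_var ^ (w i choose 2) * u i) $ n = 0" if "n < w i" for i n
  proof -
    have "x_var ^ w i * q_var ^ (w i choose 2) * u i =
        q_var ^ e i * (x_var ^ w i * q_var ^ (w i choose 2) * v i)"
      by (simp add: u(1) mult_ac)
    then show ?thesis
      using that u(2)[of i] by (simp only: fps_X_power_mult_nth) simp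
  qed
  fix n
  have "binom_twist q_var (gf w u) = partition_gf P_set"
    by (rule partition_gf_eq_binom_twist) fact+
  \<comment> \<open>The weight is constant on a fibre, so the powers of x and q depending on it
    leave the sum.\<close>
  moreover have "gf w (\<lambda>i. x_var ^ w i * q_var ^ (w i choose 2) * u i) $ m =
      x_var ^ m * binom_twist q_var (gf w u) $ m" for m
    by (simp add: gf_nth sum_distrib_left mult.assoc)
  ultimately show "(\<Sum>\<^sub>\<infinity>\<pi>\<in>P_set. x_var ^ length \<pi> * q_var ^ sum_list \<pi>) $ n =
      (\<Sum>m\<le>n. gf w (\<lambda>i. x_var ^ w i * q_var ^ (w i choose 2) * u i) $ m $ n)"
    unfolding infsumI[OF P_set_has_sum] by simp
qed

lemma divide_qpoch:
  fixes g :: "'b::field fps fps"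
  shows "g / (qpoch q_fps q_fps i * qpoch (q_fps^2) (q_fps^2) j * qpoch (q_fps^3) (q_fps^3) k *
      qpoch (q_fps^4) (q_fps^4) l) =
    g * (inv_qpoch 1 i * inv_qpoch 2 j * inv_qpoch 3 k * inv_qpoch 4 l)"
proof (rule fps_divide_eqI)
  let ?P = "\<lambda>d. qpoch (q_fps ^ d) (q_fps ^ d) :: nat \<Rightarrow> 'b fps fps"
  have "inv_qpoch 1 i * inv_qpoch 2 j * inv_qpoch 3 k * inv_qpoch 4 l *
      (?P 1 i * ?P 2 j * ?P 3 k * ?P 4 l) =
      (inv_qpoch 1 i * ?P 1 i) * (inv_qpoch 2 j * ?P 2 j) * (inv_qpoch 3 k * ?P 3 k) *
      (inv_qpoch 4 l * ?P 4 l)"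
    by (simp only: mult_ac)
  also have "\<dots> = 1" by (simp only: inv_qpoch_mult zero_less_one zero_less_numeral mult_1)
  finally show "g = g * (inv_qpoch 1 i * inv_qpoch 2 j * inv_qpoch 3 k * inv_qpoch 4 l) *
      (qpoch q_fps q_fps i * ?P 2 j * ?P 3 k * ?P 4 l)"
    by (simp only: mult.assoc mult_1_right power_one_right)
qed (simp add: qpoch_nth_0 qpoch_nth_0[of 1, simplified])

section \<open>Evaluation of the two multisums\<close>

lemma triple_sum_has_sum:
  "((\<lambda>(i, j, k).
      x_var ^ (i + 2*j + 3*k) *
      q_var ^ ((i + 2*j + 3*k) * (i + 2*j + 3*k - 1) div 2 + 2*i + j^2 + 4*j + 5*k) /
      (qpoch q_var q_var i * qpoch (q_var^2) (q_var^2) j * qpoch (q_var^3) (q_var^3) k))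
    has_sum (\<Sum>\<^sub>\<infinity>\<pi>\<in>P_set. x_var ^ length \<pi> * q_var ^ sum_list \<pi>)) (UNIV :: (nat \<times> nat \<times> nat) set)"
proof -
  define a where "a k = q_var ^ (2 * k) * inv_qpoch 1 k" for k
  \<comment> \<open>\<open>1 ^ k\<close> supplies the sign \<sigma> = 1; the exponent grows by 2k +
    5, so d = 2 and r = 5.\<close>
  define b where "b k = 1 ^ k * q_var ^ (k^2 + 4 * k) * inv_qpoch 2 k" for k
  define c where "c k = q_var ^ (5 * k) * inv_qpoch 3 k" for k
  define w :: "nat \<times> nat \<times> nat \<Rightarrow> nat" where "w = (\<lambda>(i, j, k). i + 2*j + 3*k)"
  define u where "u = (\<lambda>(i, j, k). a i * (b j * c k))"
  define A B C where "A = gf (\<lambda>k. 1 * k) a" and "B = gf (\<lambda>k. 2 * k) b" and "C = gf (\<lambda>k. 3 * k) c"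
  have A: "(1 - fps_const (q_var^2) * fps_X ^ 1) * A = dilate q_var A"
    unfolding A_def a_def by (rule gf_inv_qpoch_recurrence) simp
  have B: "B = (1 + fps_const (1 * q_var^5) * fps_X ^ 2) * dilate q_var B"
    unfolding B_def b_def by (rule gf_theta_inv_qpoch_recurrence) (simp_all add: power2_eq_square)
  have C: "(1 - fps_const (q_var^5) * fps_X ^ 3) * C = dilate q_var C"
    unfolding C_def c_def by (rule gf_inv_qpoch_recurrence) simp
  have fin: "finite {p. w p = m}" for m
  proof -
    have "finite {p. (case p of (i, p) \<Rightarrow> 1 * i + (case p of (j, k) \<Rightarrow> 2 * j + 3 * k)) = m}"
      by (intro finite_fibre_prod finite_scaled_fibre) simp_all
    then show ?thesis by (simp add: w_def case_prod_unfold add.assoc)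
  qed
  have gf: "gf w u = A * (B * C)"
  proof -
    have BC: "B * C = gf (\<lambda>(j, k). 2 * j + 3 * k) (\<lambda>(j, k). b j * c k)"
      unfolding B_def C_def by (intro gf_mult finite_scaled_fibre) simp_all
    show ?thesis
      unfolding BC A_def
      by (subst gf_mult, (intro finite_fibre_prod finite_scaled_fibre; simp)+)
        (simp add: w_def u_def case_prod_unfold add.assoc)
  qed
  have "((\<lambda>p. x_var ^ w p * q_var ^ (w p choose 2) * u p) has_sum
    (\<Sum>\<^sub>\<infinity>\<pi>\<in>P_set. x_var ^ length \<pi> * q_var ^ sum_list \<pi>)) UNIV"
  proof (rule has_sum_infsum_P_set[OF fin])
    show "u p = q_var ^ (case p of (i, j, k) \<Rightarrow> 2*i + j^2 + 4*j + 5*k) *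
        (case p of (i, j, k) \<Rightarrow> inv_qpoch 1 i * inv_qpoch 2 j * inv_qpoch 3 k)" for p
      by (simp add: u_def a_def b_def c_def power_add mult_ac split: prod.split)
    show "w p \<le> (case p of (i, j, k) \<Rightarrow> 2*i + j^2 + 4*j + 5*k)" for p
      by (simp add: w_def split: prod.split)
    have "(1 - fps_const (q_var^2) * fps_X) * (1 - fps_const (q_var^5) * fps_X^3) * gf w u =
        ((1 - fps_const (q_var^2) * fps_X ^ 1) * A) * (B * ((1 - fps_const (q_var^5) * fps_X^3) * C))"
      unfolding gf power_one_right by (simp only: mult_ac)
    also have "\<dots> = (1 + fps_const (q_var^5) * fps_X^2) * dilate q_var (gf w u)"
      unfolding A C gf dilate_mult by (subst B) (simp only: mult_ac mult_1_left)
    finally show "(1 - fps_const (q_var^2) * fps_X) * (1 - fps_const (q_var^5) * fps_X^3) * gf w u =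
      (1 + fps_const (q_var^5) * fps_X^2) * dilate q_var (gf w u)" .
    show "gf w u $ 0 = 1"
      by (simp add: gf A_def B_def C_def gf_scaled_nth gf_scaled_nth[of 1, simplified] a_def b_def c_def)
  qed
  also have "(\<lambda>p. x_var ^ w p * q_var ^ (w p choose 2) * u p) = (\<lambda>(i, j, k).
      x_var ^ (i + 2*j + 3*k) *
      q_var ^ ((i + 2*j + 3*k) * (i + 2*j + 3*k - 1) div 2 + 2*i + j^2 + 4*j + 5*k) /
      (qpoch q_var q_var i * qpoch (q_var^2) (q_var^2) j * qpoch (q_var^3) (q_var^3) k))"
  proof (intro ext, clarify)
    fix i j k :: nat
    show "x_var ^ w (i, j, k) * q_var ^ (w (i, j, k) choose 2) * u (i, j, k) =
      x_var ^ (i + 2*j + 3*k) *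
      q_var ^ ((i + 2*j + 3*k) * (i + 2*j + 3*k - 1) div 2 + 2*i + j^2 + 4*j + 5*k) /
      (qpoch q_var q_var i * qpoch (q_var^2) (q_var^2) j * qpoch (q_var^3) (q_var^3) k)"
      \<comment> \<open>Three factors are the case l = 0 of four, the last symbol being an empty
        product.\<close>
      unfolding divide_qpoch[of _ i j k 0, unfolded qpoch_def[of _ _ 0] lessThan_0 prod.empty
          mult_1_right inv_qpoch_0]
      by (simp only: w_def u_def a_def b_def c_def choose_two power_add mult_ac case_prod_conv
          power_one mult_1_left)
  qed
  finally show ?thesis .
qed

lemma quadruple_sum_has_sum:
  "((\<lambda>(i, j, k, l). let M = i + 2*j + 3*k + 4*l in
      (- 1) ^ l *
      (x_var ^ M * q_var ^ (M * (M - 1) div 2 + 2*i + 5*j + 5*k + 2 * l^2 + 8*l) /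
      (qpoch q_var q_var i * qpoch (q_var^2) (q_var^2) j *
       qpoch (q_var^3) (q_var^3) k * qpoch (q_var^4) (q_var^4) l)))
    has_sum (\<Sum>\<^sub>\<infinity>\<pi>\<in>P_set. x_var ^ length \<pi> * q_var ^ sum_list \<pi>)) (UNIV :: (nat \<times> nat \<times> nat \<times> nat) set)"
proof -
  define a where "a k = q_var ^ (2 * k) * inv_qpoch 1 k" for k
  define b where "b k = q_var ^ (5 * k) * inv_qpoch 2 k" for k
  define c where "c k = q_var ^ (5 * k) * inv_qpoch 3 k" for k
  \<comment> \<open>Here \<sigma> = -1, and the exponent grows by 4k + 10, so d = 4 and r =
    10.\<close>
  define d where "d k = (- 1) ^ k * q_var ^ (2 * k^2 + 8 * k) * inv_qpoch 4 k" for k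
  define w :: "nat \<times> nat \<times> nat \<times> nat \<Rightarrow> nat" where "w = (\<lambda>(i, j, k, l). i + 2*j + 3*k + 4*l)"
  define u where "u = (\<lambda>(i, j, k, l). a i * (b j * (c k * d l)))"
  define A B C D where "A = gf (\<lambda>k. 1 * k) a" and "B = gf (\<lambda>k. 2 * k) b"
    and "C = gf (\<lambda>k. 3 * k) c" and "D = gf (\<lambda>k. 4 * k) d"
  have A: "(1 - fps_const (q_var^2) * fps_X ^ 1) * A = dilate q_var A"
    unfolding A_def a_def by (rule gf_inv_qpoch_recurrence) simp
  have B: "(1 - fps_const (q_var^5) * fps_X ^ 2) * B = dilate q_var B"
    unfolding B_def b_def by (rule gf_inv_qpoch_recurrence) simp
  have C: "(1 - fps_const (q_var^5) * fps_X ^ 3) * C = dilate q_var C"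
    unfolding C_def c_def by (rule gf_inv_qpoch_recurrence) simp
  have D: "D = (1 + fps_const (- 1 * q_var^10) * fps_X ^ 4) * dilate q_var D"
    unfolding D_def d_def by (rule gf_theta_inv_qpoch_recurrence) (simp_all add: power2_eq_square)
  have fin: "finite {p. w p = m}" for m
  proof -
    have "finite {p. (case p of (i, p) \<Rightarrow> 1 * i + (case p of (j, p) \<Rightarrow> 2 * j +
        (case p of (k, l) \<Rightarrow> 3 * k + 4 * l))) = m}"
      by (intro finite_fibre_prod finite_scaled_fibre) simp_all
    then show ?thesis by (simp add: w_def case_prod_unfold add.assoc)
  qed
  have gf: "gf w u = A * (B * (C * D))"
  proof -
    have CD: "C * D = gf (\<lambda>(k, l). 3 * k + 4 * l) (\<lambda>(k, l). c k * d l)"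
      unfolding C_def D_def by (intro gf_mult finite_scaled_fibre) simp_all
    have BCD: "B * (C * D) = gf (\<lambda>(j, p). 2 * j + (case p of (k, l) \<Rightarrow> 3 * k + 4 * l))
        (\<lambda>(j, p). b j * (case p of (k, l) \<Rightarrow> c k * d l))"
      unfolding CD B_def by (intro gf_mult finite_fibre_prod finite_scaled_fibre) simp_all
    show ?thesis
      unfolding BCD A_def
      by (subst gf_mult, (intro finite_fibre_prod finite_scaled_fibre; simp)+)
        (simp add: w_def u_def case_prod_unfold add.assoc)
  qed
  have "((\<lambda>p. x_var ^ w p * q_var ^ (w p choose 2) * u p) has_sum
    (\<Sum>\<^sub>\<infinity>\<pi>\<in>P_set. x_var ^ length \<pi> * q_var ^ sum_list \<pi>)) UNIV"
  proof (rule has_sum_infsum_P_set[OF fin])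
    show "u p = q_var ^ (case p of (i, j, k, l) \<Rightarrow> 2*i + 5*j + 5*k + 2 * l^2 + 8*l) *
        (case p of (i, j, k, l) \<Rightarrow>
          (- 1) ^ l * (inv_qpoch 1 i * inv_qpoch 2 j * inv_qpoch 3 k * inv_qpoch 4 l))" for p
      by (simp add: u_def a_def b_def c_def d_def power_add mult_ac split: prod.split)
    show "w p \<le> (case p of (i, j, k, l) \<Rightarrow> 2*i + 5*j + 5*k + 2 * l^2 + 8*l)" for p
      by (simp add: w_def split: prod.split)
    let ?E = "1 - fps_const (q_var^5) * fps_X^2 :: rat fps fps fps"
    let ?E' = "1 + fps_const (q_var^5) * fps_X^2 :: rat fps fps fps"
    \<comment> \<open>One factor 1 - q^10 z^4 from D against one factor 1 - q^5 z^2 from B leaves 1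
      + q^5 z^2, as in the triple sum.\<close>
    have E: "?E * ?E' = 1 + fps_const (- 1 * q_var^10) * fps_X ^ 4"
      by (simp add: algebra_simps flip: power_add fps_const_neg)
    have "?E * ((1 - fps_const (q_var^2) * fps_X) * (1 - fps_const (q_var^5) * fps_X^3) * gf w u) =
        ((1 - fps_const (q_var^2) * fps_X ^ 1) * A) * ((?E * B) *
          (((1 - fps_const (q_var^5) * fps_X^3) * C) * D))"
      unfolding gf power_one_right by (simp only: mult_ac)
    also have "\<dots> = ?E * (?E' * dilate q_var (gf w u))"
      unfolding A B C gf dilate_mult by (subst D, unfold E[symmetric]) (simp only: mult_ac)
    finally have eq: "?E * ((1 - fps_const (q_var^2) * fps_X) * (1 - fps_const (q_var^5) * fps_X^3) * gf w u) =
      ?E * (?E' * dilate q_var (gf w u))" .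
    \<comment> \<open>A nonzero constant term makes \<open>?E\<close> nonzero, hence cancellable in
      an integral domain.\<close>
    have "?E $ 0 = 1" by simp
    then have "?E \<noteq> 0" by (metis fps_zero_nth zero_neq_one)
    with eq show "(1 - fps_const (q_var^2) * fps_X) * (1 - fps_const (q_var^5) * fps_X^3) * gf w u =
      ?E' * dilate q_var (gf w u)"
      by (metis mult_left_cancel)
    show "gf w u $ 0 = 1"
      by (simp add: gf A_def B_def C_def D_def gf_scaled_nth gf_scaled_nth[of 1, simplified]
          a_def b_def c_def d_def)
  qed
  also have "(\<lambda>p. x_var ^ w p * q_var ^ (w p choose 2) * u p) =
      (\<lambda>(i, j, k, l). let M = i + 2*j + 3*k + 4*l in
        (- 1) ^ l *
        (x_var ^ M * q_var ^ (M * (M - 1) div 2 + 2*i + 5*j + 5*k + 2 * l^2 + 8*l) /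
        (qpoch q_var q_var i * qpoch (q_var^2) (q_var^2) j *
         qpoch (q_var^3) (q_var^3) k * qpoch (q_var^4) (q_var^4) l)))"
    unfolding divide_qpoch Let_def
    by (intro ext, clarify)
      (simp only: w_def u_def a_def b_def c_def d_def choose_two power_add
        mult_ac case_prod_conv)
  finally show ?thesis .
qed

theorem mainTheorem7:
  shows "(\<lambda>\<pi>. x_var ^ length \<pi> * q_var ^ sum_list \<pi>) summable_on P_set \<and>
    ((\<lambda>(i, j, k).
        x_var ^ (i + 2*j + 3*k) *
        q_var ^ ((i + 2*j + 3*k) * (i + 2*j + 3*k - 1) div 2 + 2*i + j^2 + 4*j + 5*k) /
        (qpoch q_var q_var i * qpoch (q_var^2) (q_var^2) j * qpoch (q_var^3) (q_var^3) k))
      has_sum (\<Sum>\<^sub>\<infinity>\<pi>\<in>P_set. x_var ^ length \<pi> * q_var ^ sum_list \<pi>)) (UNIV :: (nat \<times> nat \<times> nat) set) \<and>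
    ((\<lambda>(i, j, k, l). let M = i + 2*j + 3*k + 4*l in
        (- 1) ^ l *
        (x_var ^ M * q_var ^ (M * (M - 1) div 2 + 2*i + 5*j + 5*k + 2 * l^2 + 8*l) /
        (qpoch q_var q_var i * qpoch (q_var^2) (q_var^2) j *
         qpoch (q_var^3) (q_var^3) k * qpoch (q_var^4) (q_var^4) l)))
      has_sum (\<Sum>\<^sub>\<infinity>\<pi>\<in>P_set. x_var ^ length \<pi> * q_var ^ sum_list \<pi>)) (UNIV :: (nat \<times> nat \<times> nat \<times> nat) set)"
  \<comment> \<open>Summability ensures that the infinite sum over \<open>P_set\<close> is the
    actual generating function and not a default value.\<close>
  using P_set_has_sum triple_sum_has_sum quadruple_sum_has_sum
  by (auto simp: summable_on_def)

end
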